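(* Let $\alpha\in(0,d)$ and let $p$ satisfy $2\le p\le\frac{2d}{\alpha}$. For all sufficiently large $N$, there exist a set $S\subset\mathbb{Z}_N^d$ with $|S|\approx N^{\alpha}$ and a function $f:\mathbb{Z}_N^d\to\mathbb{C}$ with $\operatorname{supp}\widehat f\subset S$ such that $$\|f\|_{L^\infty(\mathbb{Z}_N^d)}\;\approx\;N^{-d/2}\,\|f\|_{L^p(\mathbb{Z}_N^d)}\,\|\widehat{\mathbf{1}_S}\|_{L^{p'}(\mathbb{Z}_N^d)},$$ where the implied constants depend only on $d$ and $p$.
   Context: Here $d$ is a positive integer and $\mathbb{Z}_N^d$ is the $d$-fold product of the cyclic group $\mathbb{Z}_N$ of order $N$. For $f:\mathbb{Z}_N^d\to\mathbb{C}$ the Fourier transform $\widehat f:\mathbb{Z}_N^d\to\mathbb{C}$ is $\widehat f(m)=N^{-d/2}\sum_{x\in\mathbb{Z}_N^d} f(x)e^{-2\pi i\, x\cdot m/N}$, where $x\cdot m=\sum_{j=1}^d x_jm_j$. Norms (of functions and of their Fourier transforms) are with respect to counting measure: $\|f\|_{L^p(\mathbb{Z}_N^d)}=\left(\sum_{x\in\mathbb{Z}_N^d}|f(x)|^p\right)^{1/p}$ for $1\le p<\infty$ and $\|f\|_{L^\infty(\mathbb{Z}_N^d)}=\max_{x\in\mathbb{Z}_N^d}|f(x)|$. The conjugate exponent $p'$ satisfies $\frac1p+\frac1{p'}=1$. $\mathbf{1}_S$ is the characteristic function of $S$, and $\operatorname{supp}$ denotes the set of points where a function is nonzero. $A\approx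 B$ means $C_1B\le A\le C_2B$ with positive constants $C_1,C_2$ (the implied constants) independent of $N$. *)

theory Defs
  imports Complex_Main "HOL-Library.Indicator_Function" "HOL-Algebra.Product_Groups"
    "HOL-Algebra.Elementary_Groups"
begin

text \<open>The underlying set of the group \<open>\<int>\<^sub>N\<^sup>d\<close>. Residue classes are represented by
  \<open>0, \<dots>, N - 1\<close> (for \<open>N > 0\<close>), and vectors by functions that are \<^const>\<open>undefined\<close>
  outside \<open>{..<d}\<close>. A function on \<open>\<int>\<^sub>N\<^sup>d\<close> is a total function on \<^typ>\<open>nat \<Rightarrow> int\<close> of which
  only the values on this set are ever used. The character \<open>exp (- 2 \<pi> i x\<cdot>m / N)\<close> depends
  only on the residues of \<open>x\<close> and \<open>m\<close>, so the dot product is taken in the integers.\<close>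

definition ZN :: "nat \<Rightarrow> nat \<Rightarrow> (nat \<Rightarrow> int) set" where
  "ZN d N = carrier (product_group {..<d} (\<lambda>_. integer_mod_group N))"

lemma ZN_eq_PiE: "N > 0 \<Longrightarrow> ZN d N = ({..<d} \<rightarrow>\<^sub>E {0..<int N})"
  by (simp add: ZN_def carrier_integer_mod_group)

lemma finite_ZN: "N > 0 \<Longrightarrow> finite (ZN d N)"
  by (simp add: ZN_eq_PiE finite_PiE)

lemma card_ZN: "N > 0 \<Longrightarrow> card (ZN d N) = N ^ d"
  by (simp add: ZN_eq_PiE card_PiE)

definition dotp :: "nat \<Rightarrow> (nat \<Rightarrow> int) \<Rightarrow> (nat \<Rightarrow> int) \<Rightarrow> int" where
  "dotp d x m = (\<Sum>j<d. x j * m j)"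

definition fourier :: "nat \<Rightarrow> nat \<Rightarrow> ((nat \<Rightarrow> int) \<Rightarrow> complex) \<Rightarrow> (nat \<Rightarrow> int) \<Rightarrow> complex" where
  "fourier d N f m =
     complex_of_real (real N powr (- (real d / 2))) *
     (\<Sum>x\<in>ZN d N. f x * exp (- (2 * complex_of_real pi * \<i> * of_int (dotp d x m) / of_nat N)))"

definition supp :: "nat \<Rightarrow> nat \<Rightarrow> ((nat \<Rightarrow> int) \<Rightarrow> complex) \<Rightarrow> (nat \<Rightarrow> int) set" where
  "supp d N f = {x \<in> ZN d N. f x \<noteq> 0}"

definition lp_norm :: "nat \<Rightarrow> nat \<Rightarrow> real \<Rightarrow> ((nat \<Rightarrow> int) \<Rightarrow> complex) \<Rightarrow> real" where
  "lp_norm d N p f = (\<Sum>x\<in>ZN d N. cmod (f x) powr p) powr (1 / p)"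

definition linf_norm :: "nat \<Rightarrow> nat \<Rightarrow> ((nat \<Rightarrow> int) \<Rightarrow> complex) \<Rightarrow> real" where
  "linf_norm d N f = Max ((\<lambda>x. cmod (f x)) ` ZN d N)"

end

theory Submission
  imports Defs "HOL-Analysis.Analysis"
begin

text \<open>Take \<open>S\<close> to be a cube \<open>{0..<L}\<^sup>d\<close> with \<open>L = \<lceil>N\<^bsup>\<alpha>/d\<^esup>\<rceil>\<close> and \<open>f\<close> the inverse Fourier
  transform of \<open>1\<^sub>S\<close>, which is the complex conjugate of the transform of \<open>1\<^sub>S\<close>. Everything factors
  over the coordinates, so it suffices to show \<open>\<parallel>D\<parallel>\<^sub>p \<parallel>D\<parallel>\<^bsub>p'\<^esub> \<approx> N L\<close> for the one-dimensional
  Dirichlet kernel \<open>D\<close> of length \<open>L\<close>. The lower bound is Hoelder's inequality together with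
  \<open>\<parallel>D\<parallel>\<^sub>2\<^sup>2 = N L\<close>, and the upper bound follows from \<open>\<bar>D(k)\<bar> \<lesssim> L / (1 + L \<bar>k\<bar> / N)\<close>, which gives
  \<open>\<parallel>D\<parallel>\<^sub>q\<^sup>q \<lesssim> L\<^bsup>q-1\<^esup> N\<close> for every \<open>q > 1\<close>.\<close>

section \<open>Hoelder's inequality, Jordan's inequality and a power sum\<close>

lemma Holder_inequality_sum:
  fixes a b :: "'a \<Rightarrow> real"
  assumes pq: "p > 1" "q > 1" "1 / p + 1 / q = 1"
    and "finite A" and a: "\<And>x. x \<in> A \<Longrightarrow> 0 \<le> a x" and b: "\<And>x. x \<in> A \<Longrightarrow> 0 \<le> b x"
  shows "(\<Sum>x\<in>A. a x * b x) \<le> (\<Sum>x\<in>A. a x powr p) powr (1 / p) * (\<Sum>x\<in>A. b x powr q) powr (1 / q)"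
proof -
  define U V where "U = (\<Sum>x\<in>A. a x powr p)" and "V = (\<Sum>x\<in>A. b x powr q)"
  show ?thesis
  proof (cases "U = 0 \<or> V = 0")
    case True
    then have "\<forall>x\<in>A. a x = 0 \<or> b x = 0"
      using \<open>finite A\<close> by (auto simp: U_def V_def sum_nonneg_eq_0_iff)
    then have "(\<Sum>x\<in>A. a x * b x) = 0" by (auto intro!: sum.neutral)
    then show ?thesis by simp
  next
    case False
    have "U \<ge> 0" "V \<ge> 0" unfolding U_def V_def by (auto intro: sum_nonneg)
    with False have "U > 0" "V > 0" by auto
    define u v where "u = U powr (1 / p)" and "v = V powr (1 / q)"
    have uv: "u > 0" "v > 0" "u powr p = U" "v powr q = V"
      using \<open>U > 0\<close> \<open>V > 0\<close> pq by (auto simp: u_def v_def powr_powr)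
    \<comment> \<open>Dividing by the norms \<open>u\<close> and \<open>v\<close> reduces to unit
      norms, where summing Young's inequality gives \<open>1 / p + 1 / q\<close>, which is
      1.\<close>
    have "(\<Sum>x\<in>A. a x * b x) / (u * v) = (\<Sum>x\<in>A. (a x / u) * (b x / v))"
      by (simp add: sum_divide_distrib)
    also have "\<dots> \<le> (\<Sum>x\<in>A. (a x / u) powr p / p + (b x / v) powr q / q)"
      using pq a b uv by (intro sum_mono Youngs_inequality) auto
    also have "\<dots> = (\<Sum>x\<in>A. a x powr p) / (U * p) + (\<Sum>x\<in>A. b x powr q) / (V * q)"
      using a b uv by (simp add: sum.distrib powr_divide sum_divide_distrib)
    also have "\<dots> = 1"
      using pq \<open>U > 0\<close> \<open>V > 0\<close> by (simp flip: U_def V_def)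
    finally show ?thesis
      using uv unfolding U_def[symmetric] V_def[symmetric] u_def[symmetric] v_def[symmetric]
      by (simp add: divide_le_eq)
  qed
qed

text \<open>Jordan's inequality: sine is concave on [0, pi], hence lies above its chord from 0 to
  pi/2.\<close>

lemma sin_ge_linear:
  fixes x :: real
  assumes "0 \<le> x" "x \<le> pi / 2"
  shows "2 * x / pi \<le> sin x"
proof -
  have "concave_on {0..pi} (sin :: real \<Rightarrow> real)"
    by (rule f''_le0_imp_concave[where f' = cos and f'' = "\<lambda>x. - sin x"])
       (auto intro!: derivative_eq_intros sin_ge_zero)
  moreover have "x = (1 - 2 * x / pi) *\<^sub>R 0 + (2 * x / pi) *\<^sub>R (pi / 2)"
    by simp
  ultimately have "sin x \<ge> (1 - 2 * x / pi) * sin 0 + (2 * x / pi) * sin (pi / 2)"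
    using assms concave_onD[of "{0..pi}" sin "2 * x / pi" 0 "pi / 2"] by (simp add: field_simps)
  then show ?thesis by simp
qed

text \<open>The terms with \<open>k \<ge> 1\<close> are compared with the integral of \<open>(1 + x / t)\<^bsup>-q\<^esup>\<close>.\<close>

lemma sum_powr_minus_le:
  fixes t q :: real
  assumes "t \<ge> 1" "q > 1"
  shows "(\<Sum>k\<le>n. (1 + real k / t) powr (- q)) \<le> q / (q - 1) * t"
proof -
  \<comment> \<open>\<open>F x\<close> is the integral of (1 + u / t) powr (- q) over u from x to
    infinity, so it is nonnegative and decreasing.\<close>
  define F where "F = (\<lambda>x. t / (q - 1) * (1 + x / t) powr (1 - q))"
  have step: "(1 + real (Suc k) / t) powr (- q) \<le> F (real k) - F (real (Suc k))" for k
  proof -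
    have "\<exists>z. real k < z \<and> z < real (Suc k) \<and> F (real (Suc k)) - F (real k) =
        (real (Suc k) - real k) * (- ((1 + z / t) powr (- q)))"
    proof (rule MVT2)
      fix x assume x: "real k \<le> x" "x \<le> real (Suc k)"
      have "1 + x / t > 0" using x assms by (simp add: add_pos_nonneg)
      then have "((\<lambda>x. (1 + x / t) powr (1 - q)) has_real_derivative
          (1 - q) * (1 + x / t) powr (1 - q - 1) * (1 / t)) (at x)"
        using assms by (intro DERIV_chain2[OF has_real_derivative_powr])
          (auto intro!: derivative_eq_intros)
      from DERIV_cmult[OF this, of "t / (q - 1)"]
      have "(F has_real_derivative t / (q - 1) * ((1 - q) * (1 + x / t) powr (- q) * (1 / t))) (at x)"
        unfolding F_def by simp
      moreover have "t / (q - 1) * ((1 - q) * y * (1 / t)) = - y" for y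
        using assms by (simp add: divide_simps) (simp add: algebra_simps)
      ultimately show "(F has_real_derivative - ((1 + x / t) powr (- q))) (at x)"
        by simp
    qed simp
    then obtain z where z: "real k < z" "z < real (Suc k)"
      "F (real k) - F (real (Suc k)) = (1 + z / t) powr (- q)" by auto
    have "(1 + real (Suc k) / t) powr (- q) \<le> (1 + z / t) powr (- q)"
      using z assms by (intro powr_mono2') (auto intro!: add_pos_nonneg divide_right_mono)
    with z show ?thesis by simp
  qed
  \<comment> \<open>The term at 0 equals 1, which \<open>t \<ge> 1\<close> absorbs below; the others
    telescope.\<close>
  have "(\<Sum>k\<le>n. (1 + real k / t) powr (- q)) \<le> 1 + F 0 - F (real n)"
  proof (induction n)
    case (Suc n)
    then show ?case using step[of n] by simp
  qed simp
  also have "\<dots> \<le> t + t / (q - 1)"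
  proof -
    have "F (real n) \<ge> 0" "F 0 = t / (q - 1)" using assms by (simp_all add: F_def)
    with \<open>t \<ge> 1\<close> show ?thesis by linarith
  qed
  also have "\<dots> = q / (q - 1) * t"
    using assms by (simp add: field_simps)
  finally show ?thesis .
qed

lemma sum_int_atLeastLessThan: "(\<Sum>a\<in>{0..<int n}. h a) = (\<Sum>a<n. h (int a))"
proof -
  have "{0..<int n} = int ` {..<n}"
    by (simp add: lessThan_atLeast0 image_int_atLeastLessThan)
  then show ?thesis by (simp add: sum.reindex)
qed

section \<open>Characters of the cyclic group\<close>

definition unity_char :: "nat \<Rightarrow> int \<Rightarrow> complex" where
  "unity_char N k = cis (- (2 * pi * real_of_int k / real N))"

lemma exp_eq_unity_char:
  "exp (- (2 * complex_of_real pi * \<i> * of_int k / of_nat N)) = unity_char N k"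
  by (simp add: unity_char_def cis_conv_exp mult_ac)

lemma unity_char_0 [simp]: "unity_char N 0 = 1"
  by (simp add: unity_char_def)

lemma unity_char_add: "unity_char N (a + b) = unity_char N a * unity_char N b"
  by (simp add: unity_char_def cis_mult ring_distribs add_divide_distrib)

lemma unity_char_minus: "unity_char N (- a) = cnj (unity_char N a)"
  by (simp add: unity_char_def cis_cnj)

lemma norm_unity_char [simp]: "cmod (unity_char N a) = 1"
  by (simp add: unity_char_def)

lemma unity_char_sum: "unity_char N (sum h A) = (\<Prod>j\<in>A. unity_char N (h j))"
  by (induction A rule: infinite_finite_induct) (auto simp: unity_char_add)

lemma unity_char_power: "unity_char N (int a * k) = unity_char N k ^ a"
  by (induction a) (auto simp: unity_char_add ring_distribs)

lemma unity_char_period: "N > 0 \<Longrightarrow> unity_char N (int N * k) = 1"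
  by (simp add: unity_char_def complex_eq_iff sin_int_2pin cos_int_2pin flip: mult.assoc)

text \<open>A chord of the unit circle subtending the angle a has length 2 |sin (a / 2)|.\<close>

lemma norm_unity_char_minus_1:
  "cmod (unity_char N k - 1) = 2 * \<bar>sin (pi * real_of_int k / real N)\<bar>"
  using dist_exp_i_1[of "- (2 * pi * real_of_int k / real N)"]
  by (simp add: unity_char_def cis_conv_exp)

text \<open>Up to half a period the half-angle stays in [0, pi/2], where Jordan's inequality
  applies.\<close>

lemma norm_unity_char_minus_1_ge:
  assumes "N > 0" "0 \<le> k" "2 * k \<le> int N"
  shows "4 * real_of_int k / real N \<le> cmod (unity_char N k - 1)"
proof -
  have k: "2 * real_of_int k \<le> real N" using assms by linarith
  have "2 * (pi * real_of_int k / real N) / pi \<le> sin (pi * real_of_int k / real N)"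
    using assms k by (intro sin_ge_linear) (auto simp: field_simps)
  moreover have "2 * (pi * real_of_int k / real N) / pi = 2 * real_of_int k / real N"
    by simp
  ultimately show ?thesis
    unfolding norm_unity_char_minus_1 by linarith
qed

lemma unity_char_neq_1:
  assumes "0 < k" "k < int N"
  shows "unity_char N k \<noteq> 1"
proof -
  have "0 < real_of_int k" "real_of_int k < real N" using assms by linarith+
  then have "sin (pi * real_of_int k / real N) > 0"
    by (intro sin_gt_zero) (auto simp: field_simps)
  then show ?thesis
    using norm_unity_char_minus_1[of N k] by auto
qed

section \<open>Pointwise bounds for the Dirichlet kernel\<close>

definition dirichlet :: "nat \<Rightarrow> nat \<Rightarrow> int \<Rightarrow> complex" where
  "dirichlet N L k = (\<Sum>a\<in>{0..<int L}. unity_char N (a * k))"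

lemma dirichlet_eq_geometric: "dirichlet N L k = (\<Sum>a<L. unity_char N k ^ a)"
  by (simp add: dirichlet_def sum_int_atLeastLessThan unity_char_power)

lemma dirichlet_0 [simp]: "dirichlet N L 0 = of_nat L"
  by (simp add: dirichlet_def)

lemma norm_dirichlet_le: "cmod (dirichlet N L k) \<le> real L"
  unfolding dirichlet_def by (rule order_trans[OF norm_sum]) simp

lemma dirichlet_period: "N > 0 \<Longrightarrow> dirichlet N L (int N + k) = dirichlet N L k"
  using unity_char_period[of N 1] by (simp add: dirichlet_eq_geometric unity_char_add)

lemma dirichlet_minus: "dirichlet N L (- k) = cnj (dirichlet N L k)"
  by (simp add: dirichlet_def unity_char_minus)

text \<open>Multiplying the geometric sum by its ratio minus 1 leaves a difference of two unit
  numbers, of modulus at most 2, while that factor has modulus at least 4 k / N. The form without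
  division covers k = 0.\<close>

lemma norm_dirichlet_decay:
  assumes "N > 0" "0 \<le> k" "2 * k \<le> int N"
  shows "cmod (dirichlet N L k) * (2 * real_of_int k) \<le> real N"
proof -
  let ?z = "unity_char N k"
  have "cmod (dirichlet N L k) * (4 * real_of_int k / real N)
      \<le> cmod (dirichlet N L k) * cmod (?z - 1)"
    using norm_unity_char_minus_1_ge[OF assms] by (intro mult_left_mono) auto
  also have "\<dots> = cmod (?z ^ L - 1)"
    by (simp add: dirichlet_eq_geometric norm_mult[symmetric] power_diff_1_eq mult.commute)
  also have "\<dots> \<le> 2"
    using norm_triangle_ineq4[of "?z ^ L" 1] by (simp add: norm_power)
  finally show ?thesis using assms by (simp add: field_simps)
qed

text \<open>Adding the trivial bound L to L / N times the decay bound gives |D(k)| (1 + k L / N)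
  \<le> 3/2 L: one profile for the whole half period, of the shape summed in
  \<open>sum_powr_minus_le\<close>.\<close>

lemma norm_dirichlet_powr_le:
  assumes "N > 0" "q > 0" "0 \<le> k" "2 * k \<le> int N" "L > 0"
  shows "cmod (dirichlet N L k) powr q
    \<le> (3 / 2 * real L) powr q * (1 + real_of_int k / (real N / real L)) powr (- q)"
proof -
  let ?w = "1 + real_of_int k / (real N / real L)"
  have "?w > 0" using assms by (auto intro!: add_pos_nonneg)
  have "cmod (dirichlet N L k) * real_of_int k * real L / real N \<le> real L / 2"
  proof -
    have "cmod (dirichlet N L k) * (2 * real_of_int k) * real L \<le> real N * real L"
      using norm_dirichlet_decay[OF assms(1,3,4)] by (intro mult_right_mono) auto
    then show ?thesis using assms by (simp add: field_simps)
  qed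
  then have "cmod (dirichlet N L k) * ?w \<le> 3 / 2 * real L"
    using norm_dirichlet_le[of N L k] by (simp add: ring_distribs)
  then have "cmod (dirichlet N L k) \<le> 3 / 2 * real L / ?w"
    using \<open>?w > 0\<close> by (simp only: pos_le_divide_eq)
  then have "cmod (dirichlet N L k) powr q \<le> (3 / 2 * real L / ?w) powr q"
    using assms by (intro powr_mono2) auto
  also have "\<dots> = (3 / 2 * real L) powr q * ?w powr (- q)"
    by (simp only: powr_divide powr_minus divide_inverse[of "_ powr q" "?w powr q"])
  finally show ?thesis .
qed

section \<open>Power sums of the Dirichlet kernel over a period\<close>

definition dirichlet_sum :: "nat \<Rightarrow> nat \<Rightarrow> real \<Rightarrow> real" where
  "dirichlet_sum N L q = (\<Sum>k\<in>{0..<int N}. cmod (dirichlet N L k) powr q)"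

text \<open>Each residue lies within N/2 of 0 or of N, so the profile \<open>w\<close> at
  \<open>k\<close> or at \<open>N - k\<close> controls the kernel. Adding both avoids splitting the
  sum, at the cost of the factor 2.\<close>

lemma dirichlet_sum_le:
  assumes "0 < L" "L \<le> N" "q > 1"
  shows "dirichlet_sum N L q \<le> 2 * (3 / 2) powr q * (q / (q - 1)) * (real L powr (q - 1) * real N)"
proof -
  define t where "t = real N / real L"
  define w where "w k = (1 + real k / t) powr (- q)" for k :: nat
  define c where "c = (3 / 2 * real L) powr q"
  have "t \<ge> 1" "N > 0" using assms by (auto simp: t_def)
  have half: "cmod (dirichlet N L (int k)) powr q \<le> c * w k" if "2 * k \<le> N" for k
    using norm_dirichlet_powr_le[of N q "int k" L] that assms \<open>N > 0\<close>
    by (simp add: w_def c_def t_def)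
  have term_le: "cmod (dirichlet N L (int k)) powr q \<le> c * w k + c * w (N - k)" if "k < N" for k
  proof (cases "2 * k \<le> N")
    case True
    then show ?thesis using half[of k] by (simp add: c_def w_def add_increasing2)
  next
    case False
    \<comment> \<open>Periodicity and conjugation symmetry reflect the upper half period onto the
      lower one.\<close>
    have "dirichlet N L (int (N - k)) = cnj (dirichlet N L (int k))"
      using dirichlet_period[OF \<open>N > 0\<close>, of L "- int k"] that
      by (simp add: of_nat_diff dirichlet_minus)
    then show ?thesis using half[of "N - k"] False by (simp add: c_def w_def add_increasing)
  qed
  have w_sum: "(\<Sum>k\<le>N. w k) \<le> q / (q - 1) * t"
    unfolding w_def using \<open>t \<ge> 1\<close> assms by (intro sum_powr_minus_le) auto
  have "dirichlet_sum N L q \<le> (\<Sum>k<N. c * w k + c * w (N - k))"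
    unfolding dirichlet_sum_def sum_int_atLeastLessThan by (intro sum_mono term_le) auto
  \<comment> \<open>The index N is included so that k -> N - k permutes the range.\<close>
  also have "\<dots> \<le> (\<Sum>k\<le>N. c * w k + c * w (N - k))"
    by (intro sum_mono2) (auto simp: c_def w_def)
  also have "\<dots> = c * ((\<Sum>k\<le>N. w k) + (\<Sum>k\<le>N. w (N - k)))"
    by (simp add: sum.distrib sum_distrib_left ring_distribs)
  also have "(\<Sum>k\<le>N. w (N - k)) = (\<Sum>k\<le>N. w k)"
    by (rule sum.reindex_bij_witness[of _ "\<lambda>k. N - k" "\<lambda>k. N - k"]) auto
  also have "c * ((\<Sum>k\<le>N. w k) + (\<Sum>k\<le>N. w k)) \<le> c * (2 * (q / (q - 1) * t))"
    using w_sum by (intro mult_left_mono) (auto simp: c_def)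
  \<comment> \<open>One factor of L in \<open>c\<close> cancels the denominator of \<open>t\<close>,
    leaving the exponent \<open>q - 1\<close>.\<close>
  also have "\<dots> = 2 * (3 / 2) powr q * (q / (q - 1)) * (real L powr (q - 1) * real N)"
    using assms unfolding c_def t_def powr_mult by (simp add: powr_diff)
  finally show ?thesis .
qed

section \<open>Orthogonality, inversion and Plancherel\<close>

lemma sum_unity_char:
  assumes "\<bar>c\<bar> < int N"
  shows "(\<Sum>k\<in>{0..<int N}. unity_char N (k * c)) = (if c = 0 then of_nat N else 0)"
proof (cases "c = 0")
  case False
  \<comment> \<open>The bound on \<open>c\<close> excludes nonzero multiples of N, so the ratio of
    the geometric sum is a nontrivial root of unity. Conjugation reduces negative \<open>c\<close>
    to positive.\<close>
  have "unity_char N c \<noteq> 1"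
  proof (cases "c > 0")
    case False
    then have "unity_char N (- c) \<noteq> 1"
      using assms \<open>c \<noteq> 0\<close> by (intro unity_char_neq_1) auto
    then show ?thesis by (auto simp: unity_char_minus)
  next
    case True
    then show ?thesis using assms by (intro unity_char_neq_1) auto
  qed
  moreover have "(unity_char N c - 1) * (\<Sum>k<N. unity_char N c ^ k) = 0"
    using assms unity_char_period[of N c]
    by (simp flip: power_diff_1_eq add: unity_char_power)
  ultimately show ?thesis
    using False by (simp add: sum_int_atLeastLessThan unity_char_power)
qed simp

text \<open>Fourier inversion for the interval of length L, up to normalization: after exchanging
  the sums, orthogonality leaves only a = m. As \<open>L \<le> N\<close>, both m and a are residues,
  so |m - a| < N.\<close>

lemma dirichlet_inversion:
  assumes "L \<le> N" "0 \<le> m" "m < int N"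
  shows "(\<Sum>k\<in>{0..<int N}. cnj (dirichlet N L k) * unity_char N (k * m)) =
    (if m < int L then of_nat N else 0)"
proof -
  have "(\<Sum>k\<in>{0..<int N}. cnj (dirichlet N L k) * unity_char N (k * m)) =
      (\<Sum>k\<in>{0..<int N}. \<Sum>a\<in>{0..<int L}. unity_char N (k * (m - a)))"
    by (simp add: dirichlet_def sum_distrib_right flip: unity_char_minus unity_char_add)
       (simp add: algebra_simps)
  also have "\<dots> = (\<Sum>a\<in>{0..<int L}. \<Sum>k\<in>{0..<int N}. unity_char N (k * (m - a)))"
    by (rule sum.swap)
  also have "\<dots> = (\<Sum>a\<in>{0..<int L}. if m = a then of_nat N else 0)"
    using assms by (intro sum.cong refl) (subst sum_unity_char, auto)
  also have "\<dots> = (if m < int L then of_nat N else 0)"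
    using assms by (simp add: sum.delta)
  finally show ?thesis .
qed

text \<open>Plancherel for the interval: expanding one factor of |D|^2 turns the sum into the
  inversion formula at the L points of the interval, each contributing N.\<close>

lemma sum_norm_dirichlet_squared:
  assumes "L \<le> N"
  shows "(\<Sum>k\<in>{0..<int N}. (cmod (dirichlet N L k))\<^sup>2) = real N * real L"
proof -
  have "complex_of_real (\<Sum>k\<in>{0..<int N}. (cmod (dirichlet N L k))\<^sup>2) =
      (\<Sum>k\<in>{0..<int N}. \<Sum>a\<in>{0..<int L}. cnj (dirichlet N L k) * unity_char N (k * a))"
  proof -
    have "complex_of_real ((cmod (dirichlet N L k))\<^sup>2) =
        (\<Sum>a\<in>{0..<int L}. cnj (dirichlet N L k) * unity_char N (k * a))" for k
      unfolding sum_distrib_left[symmetric] complex_norm_square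
      by (simp add: dirichlet_def mult.commute)
    then show ?thesis by (simp only: of_real_sum)
  qed
  also have "\<dots> = (\<Sum>a\<in>{0..<int L}. \<Sum>k\<in>{0..<int N}. cnj (dirichlet N L k) * unity_char N (k * a))"
    by (rule sum.swap)
  also have "\<dots> = (\<Sum>a\<in>{0..<int L}. of_nat N)"
    using assms by (intro sum.cong refl) (subst dirichlet_inversion, auto)
  also have "\<dots> = complex_of_real (real N * real L)"
    by simp
  finally show ?thesis by (simp only: of_real_eq_iff)
qed

section \<open>Kernel norms for conjugate exponents\<close>

definition dirichlet_const :: "real \<Rightarrow> real" where
  "dirichlet_const q = (2 * (3 / 2) powr q * (q / (q - 1))) powr (1 / q)"

lemma dirichlet_norm_le:
  assumes "0 < L" "L \<le> N" "q > 1"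
  shows "dirichlet_sum N L q powr (1 / q)
    \<le> dirichlet_const q * (real L powr (1 - 1 / q) * real N powr (1 / q))"
proof -
  have "dirichlet_sum N L q powr (1 / q)
      \<le> (2 * (3 / 2) powr q * (q / (q - 1)) * (real L powr (q - 1) * real N)) powr (1 / q)"
    using assms by (intro powr_mono2 dirichlet_sum_le) (auto simp: dirichlet_sum_def intro: sum_nonneg)
  also have "\<dots> = dirichlet_const q * (real L powr ((q - 1) * (1 / q)) * real N powr (1 / q))"
    unfolding dirichlet_const_def powr_mult powr_powr by simp
  also have "(q - 1) * (1 / q) = 1 - 1 / q"
    using assms by (simp add: field_simps)
  finally show ?thesis .
qed

text \<open>Below, Hoelder's inequality is applied to |D| times itself. Above, conjugacy makes the
  exponents of L and of N in the two norm bounds each add up to 1.\<close>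

lemma dirichlet_norm_product_bounds:
  assumes "0 < L" "L \<le> N" "p > 1" "q > 1" "1 / p + 1 / q = 1"
  shows "real N * real L \<le> dirichlet_sum N L p powr (1 / p) * dirichlet_sum N L q powr (1 / q)"
    and "dirichlet_sum N L p powr (1 / p) * dirichlet_sum N L q powr (1 / q)
      \<le> dirichlet_const p * dirichlet_const q * (real N * real L)"
proof -
  show "real N * real L \<le> dirichlet_sum N L p powr (1 / p) * dirichlet_sum N L q powr (1 / q)"
    using Holder_inequality_sum[of p q "{0..<int N}" "\<lambda>k. cmod (dirichlet N L k)"
        "\<lambda>k. cmod (dirichlet N L k)"] assms
    by (simp add: dirichlet_sum_def sum_norm_dirichlet_squared flip: power2_eq_square)
  have "dirichlet_sum N L p powr (1 / p) * dirichlet_sum N L q powr (1 / q)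
      \<le> (dirichlet_const p * (real L powr (1 - 1 / p) * real N powr (1 / p))) *
        (dirichlet_const q * (real L powr (1 - 1 / q) * real N powr (1 / q)))"
    using assms by (intro mult_mono dirichlet_norm_le) (auto simp: dirichlet_const_def)
  also have "\<dots> = dirichlet_const p * dirichlet_const q *
      (real L powr (1 - 1 / p) * real L powr (1 - 1 / q)) *
      (real N powr (1 / p) * real N powr (1 / q))"
    by (simp add: mult_ac)
  also have "\<dots> = dirichlet_const p * dirichlet_const q *
      real L powr ((1 - 1 / p) + (1 - 1 / q)) * real N powr (1 / p + 1 / q)"
    by (simp only: powr_add)
  also have "(1 - 1 / p) + (1 - 1 / q) = 1"
    using assms by simp
  finally show "dirichlet_sum N L p powr (1 / p) * dirichlet_sum N L q powr (1 / q)
      \<le> dirichlet_const p * dirichlet_const q * (real N * real L)"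
    using assms by (simp add: mult_ac)
qed

section \<open>Cubes and factorization over the coordinates\<close>

definition cube :: "nat \<Rightarrow> nat \<Rightarrow> (nat \<Rightarrow> int) set" where
  "cube d L = ({..<d} \<rightarrow>\<^sub>E {0..<int L})"

lemma card_cube: "card (cube d L) = L ^ d"
  by (simp add: cube_def card_PiE)

lemma cube_subset_ZN: "0 < N \<Longrightarrow> L \<le> N \<Longrightarrow> cube d L \<subseteq> ZN d N"
  unfolding cube_def ZN_eq_PiE by (intro PiE_mono) auto

lemma sum_ZN_prod:
  fixes h :: "nat \<Rightarrow> int \<Rightarrow> 'a::comm_semiring_1"
  assumes "N > 0"
  shows "(\<Sum>x\<in>ZN d N. \<Prod>j<d. h j (x j)) = (\<Prod>j<d. \<Sum>k\<in>{0..<int N}. h j k)"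
  unfolding ZN_eq_PiE[OF assms] by (subst prod_sum_PiE) auto

lemma fourier_eq:
  "fourier d N f m = complex_of_real (real N powr (- (real d / 2))) *
    (\<Sum>x\<in>ZN d N. f x * (\<Prod>j<d. unity_char N (x j * m j)))"
  unfolding fourier_def exp_eq_unity_char dotp_def unity_char_sum ..

lemma fourier_indicator_cube:
  assumes "0 < N" "L \<le> N"
  shows "fourier d N (indicator (cube d L)) m =
    complex_of_real (real N powr (- (real d / 2))) * (\<Prod>j<d. dirichlet N L (m j))"
proof -
  have "(\<Sum>x\<in>ZN d N. indicator (cube d L) x * (\<Prod>j<d. unity_char N (x j * m j))) =
      (\<Sum>x\<in>cube d L. \<Prod>j<d. unity_char N (x j * m j))"
    using cube_subset_ZN[OF assms] finite_ZN[OF assms(1)]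
    by (intro sum.mono_neutral_cong_right) (auto simp: indicator_def)
  also have "\<dots> = (\<Prod>j<d. dirichlet N L (m j))"
    unfolding cube_def dirichlet_def by (subst prod_sum_PiE) auto
  finally show ?thesis unfolding fourier_eq by simp
qed

text \<open>The indicator is real, so conjugating its transform gives its inverse transform, and
  transforming again leads back to the cube. Coordinatewise this is
  \<open>dirichlet_inversion\<close>: one coordinate of at least L kills the product.\<close>

lemma supp_fourier_cnj_fourier_indicator_cube:
  assumes "0 < N" "L \<le> N"
  shows "supp d N (fourier d N (\<lambda>x. cnj (fourier d N (indicator (cube d L)) x))) \<subseteq> cube d L"
proof
  fix m assume m: "m \<in> supp d N (fourier d N (\<lambda>x. cnj (fourier d N (indicator (cube d L)) x)))"
  let ?c = "complex_of_real (real N powr (- (real d / 2)))"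
  from m have mZ: "m \<in> {..<d} \<rightarrow>\<^sub>E {0..<int N}" by (simp add: supp_def ZN_eq_PiE assms)
  have "fourier d N (\<lambda>x. cnj (fourier d N (indicator (cube d L)) x)) m =
      ?c * (\<Sum>x\<in>ZN d N. ?c * (\<Prod>j<d. cnj (dirichlet N L (x j)) * unity_char N (x j * m j)))"
    by (subst fourier_eq) (simp add: fourier_indicator_cube[OF assms] prod.distrib mult.assoc)
  also have "\<dots> = ?c * (?c *
      (\<Prod>j<d. \<Sum>k\<in>{0..<int N}. cnj (dirichlet N L k) * unity_char N (k * m j)))"
    using sum_ZN_prod[OF assms(1), of "\<lambda>j k. cnj (dirichlet N L k) * unity_char N (k * m j)" d]
    by (simp only: sum_distrib_left[symmetric])
  also have "\<dots> = ?c * (?c * (\<Prod>j<d. if m j < int L then of_nat N else 0))"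
  proof -
    have "0 \<le> m j \<and> m j < int N" if "j < d" for j
      using mZ that by (auto simp: PiE_iff)
    then have "(\<Prod>j<d. \<Sum>k\<in>{0..<int N}. cnj (dirichlet N L k) * unity_char N (k * m j)) =
        (\<Prod>j<d. if m j < int L then of_nat N else 0)"
      using assms by (intro prod.cong refl dirichlet_inversion) auto
    then show ?thesis by (simp only:)
  qed
  finally have "(\<Prod>j<d. if m j < int L then of_nat N else (0::complex)) \<noteq> 0"
    using m by (auto simp: supp_def)
  then have "\<forall>j<d. m j < int L" by (auto split: if_splits)
  with mZ show "m \<in> cube d L" by (auto simp: cube_def PiE_iff)
qed

text \<open>The modulus of the transform is a product of functions of single coordinates, so its
  power sum is a d-th power.\<close>

lemma lp_norm_fourier_indicator_cube:
  assumes "0 < N" "L \<le> N" "q > 0"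
  shows "lp_norm d N q (fourier d N (indicator (cube d L))) =
    real N powr (- (real d / 2)) * (dirichlet_sum N L q powr (1 / q)) ^ d"
proof -
  let ?c = "real N powr (- (real d / 2))"
  have "(\<Sum>x\<in>ZN d N. cmod (fourier d N (indicator (cube d L)) x) powr q) =
      (\<Sum>x\<in>ZN d N. ?c powr q * (\<Prod>j<d. cmod (dirichlet N L (x j)) powr q))"
    using assms by (simp add: fourier_indicator_cube norm_mult prod_norm[symmetric] powr_mult
        prod_powr_distrib)
  also have "\<dots> = ?c powr q * dirichlet_sum N L q ^ d"
    using sum_ZN_prod[OF assms(1), of "\<lambda>j k. cmod (dirichlet N L k) powr q"]
    by (simp add: dirichlet_sum_def flip: sum_distrib_left)
  finally have "lp_norm d N q (fourier d N (indicator (cube d L))) =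
      (?c powr q) powr (1 / q) * (\<Prod>j<d. dirichlet_sum N L q) powr (1 / q)"
    unfolding lp_norm_def by (simp only: powr_mult prod_constant card_lessThan)
  also have "(?c powr q) powr (1 / q) = ?c"
    using assms by (simp add: powr_powr)
  also have "(\<Prod>j<d. dirichlet_sum N L q) powr (1 / q) = (dirichlet_sum N L q powr (1 / q)) ^ d"
    unfolding prod_powr_distrib by simp
  finally show ?thesis .
qed

text \<open>The maximum is attained at the origin, where each kernel takes its largest modulus
  L.\<close>

lemma linf_norm_fourier_indicator_cube:
  assumes "0 < N" "L \<le> N"
  shows "linf_norm d N (fourier d N (indicator (cube d L))) = real N powr (- (real d / 2)) * real L ^ d"
  unfolding linf_norm_def
proof (rule Max_eqI)
  fix y assume "y \<in> (\<lambda>x. cmod (fourier d N (indicator (cube d L)) x)) ` ZN d N"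
  then obtain x where y: "y = cmod (fourier d N (indicator (cube d L)) x)" by auto
  have "(\<Prod>j<d. cmod (dirichlet N L (x j))) \<le> (\<Prod>j<d. real L)"
    by (intro prod_mono) (auto simp: norm_dirichlet_le)
  then show "y \<le> real N powr (- (real d / 2)) * real L ^ d"
    unfolding y using assms
    by (auto simp: fourier_indicator_cube norm_mult prod_norm[symmetric] intro!: mult_left_mono)
next
  have "(\<lambda>j\<in>{..<d}. 0) \<in> ZN d N" using assms by (auto simp: ZN_eq_PiE)
  moreover have "cmod (fourier d N (indicator (cube d L)) (\<lambda>j\<in>{..<d}. 0)) =
      real N powr (- (real d / 2)) * real L ^ d"
    using assms by (simp add: fourier_indicator_cube norm_mult norm_power)
  ultimately show "real N powr (- (real d / 2)) * real L ^ d
      \<in> (\<lambda>x. cmod (fourier d N (indicator (cube d L)) x)) ` ZN d N"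
    by (metis imageI)
qed (use finite_ZN assms in auto)

text \<open>The weight N^(-d/2) occurs three times in the product, once explicitly and once in each
  norm. Two copies cancel the N^d in (N L)^d, leaving N^(-d/2) L^d, the sup norm.\<close>

lemma cube_estimates:
  fixes d L N :: nat and p q :: real
  assumes "0 < L" "L \<le> N" "p > 1" "q > 1" "1 / p + 1 / q = 1"
  defines "g \<equiv> fourier d N (indicator (cube d L))"
  shows "linf_norm d N g \<le> real N powr (- (real d / 2)) * lp_norm d N p g * lp_norm d N q g"
    and "real N powr (- (real d / 2)) * lp_norm d N p g * lp_norm d N q g
      \<le> (dirichlet_const p * dirichlet_const q) ^ d * linf_norm d N g"
proof -
  let ?c = "real N powr (- (real d / 2))"
  let ?P = "dirichlet_sum N L p powr (1 / p) * dirichlet_sum N L q powr (1 / q)"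
  have N: "N > 0" using assms by simp
  have cc: "?c * ?c * real N ^ d = 1"
    using N by (simp add: powr_realpow[symmetric] flip: powr_add)
  have product: "?c * lp_norm d N p g * lp_norm d N q g = ?c * (?c * ?c * ?P ^ d)"
    unfolding g_def using assms N by (simp add: lp_norm_fourier_indicator_cube power_mult_distrib)
  \<comment> \<open>Padding by \<open>cc\<close> gives the sup norm the same form as the product, so
    both bounds reduce to comparing \<open>?P\<close> with N L.\<close>
  have linf: "linf_norm d N g = ?c * (?c * ?c * (real N * real L) ^ d)"
    unfolding g_def using assms N cc
    by (simp add: linf_norm_fourier_indicator_cube power_mult_distrib flip: mult.assoc)
  show "linf_norm d N g \<le> ?c * lp_norm d N p g * lp_norm d N q g"
    unfolding product linf using assms
    by (intro mult_left_mono power_mono dirichlet_norm_product_bounds) auto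
  have "?P ^ d \<le> (dirichlet_const p * dirichlet_const q * (real N * real L)) ^ d"
    using assms by (intro power_mono dirichlet_norm_product_bounds) auto
  then have "?c * (?c * ?c * ?P ^ d)
      \<le> ?c * (?c * ?c * (dirichlet_const p * dirichlet_const q * (real N * real L)) ^ d)"
    by (intro mult_left_mono) auto
  also have "\<dots> = (dirichlet_const p * dirichlet_const q) ^ d *
      (?c * (?c * ?c * (real N * real L) ^ d))"
    by (simp add: power_mult_distrib mult_ac)
  finally show "?c * lp_norm d N p g * lp_norm d N q g
      \<le> (dirichlet_const p * dirichlet_const q) ^ d * linf_norm d N g"
    unfolding product linf .
qed

section \<open>The side length of the cube\<close>

lemma side_length_exists:
  assumes "d > 0" "0 < \<alpha>" "\<alpha> < real d" "N > 0"
  obtains L where "0 < L" "L \<le> N" "real N powr \<alpha> \<le> real L ^ d" "real L ^ d \<le> 2 ^ d * real N powr \<alpha>"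
proof -
  define s where "s = real N powr (\<alpha> / real d)"
  have "1 \<le> s" using assms by (auto simp: s_def intro!: ge_one_powr_ge_zero)
  \<comment> \<open>Since \<open>\<alpha> < real d\<close>, the side does not exceed N, and rounding
    up preserves this because N is an integer.\<close>
  have "s \<le> real N powr 1"
    unfolding s_def using assms by (intro powr_mono) auto
  then have "s \<le> real N" using assms by simp
  have sd: "s ^ d = real N powr \<alpha>"
    using assms by (simp add: s_def powr_power)
  define L where "L = nat \<lceil>s\<rceil>"
  have L: "s \<le> real L" "real L \<le> s + 1" "L \<le> N"
    using \<open>1 \<le> s\<close> \<open>s \<le> real N\<close> unfolding L_def by linarith+
  \<comment> \<open>As \<open>1 \<le> s\<close>, rounding up at most doubles each side: s + 1 \<le>
    2 s.\<close>
  have "real L ^ d \<le> (2 * s) ^ d"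
    using L \<open>1 \<le> s\<close> by (intro power_mono) auto
  moreover have "s ^ d \<le> real L ^ d"
    using L \<open>1 \<le> s\<close> by (intro power_mono) auto
  moreover have "0 < L" using L \<open>1 \<le> s\<close> by simp
  ultimately show thesis
    using L sd by (intro that[of L]) (auto simp: power_mult_distrib)
qed

section \<open>Choice of the set, the function and the constants\<close>

theorem proposition10:
  fixes d :: nat and p p' :: real
  assumes "d > 0" and "2 \<le> p" and "1 / p + 1 / p' = 1"
  shows "\<exists>c\<^sub>1>0. \<exists>c\<^sub>2>0. \<exists>C\<^sub>1>0. \<exists>C\<^sub>2>0. \<forall>\<alpha>::real. 0 < \<alpha> \<and> \<alpha> < real d \<and> p \<le> 2 * real d / \<alpha> \<longrightarrow>
    (\<forall>\<^sub>F N in sequentially. \<exists>S f.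
       S \<subseteq> ZN d N \<and>
       c\<^sub>1 * real N powr \<alpha> \<le> real (card S) \<and> real (card S) \<le> c\<^sub>2 * real N powr \<alpha> \<and>
       supp d N f \<noteq> {} \<and>
       supp d N (fourier d N f) \<subseteq> S \<and>
       C\<^sub>1 * (real N powr (- (real d / 2)) * lp_norm d N p f * lp_norm d N p' (fourier d N (indicator S)))
         \<le> linf_norm d N f \<and>
       linf_norm d N f
         \<le> C\<^sub>2 * (real N powr (- (real d / 2)) * lp_norm d N p f * lp_norm d N p' (fourier d N (indicator S))))"
proof -
  \<comment> \<open>From \<open>2 \<le> p\<close> the reciprocal of \<open>p'\<close> lies in [1/2,
    1), which gives \<open>p' > 1\<close>; its positivity rules out the default value 1 / 0 =
    0.\<close>
  have "1 / p > 0" "1 / p \<le> 1 / 2" using assms by (auto simp: field_simps)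
  with assms(3) have inv: "1 / p' > 0" "1 / p' < 1" by linarith+
  then have p': "p' > 1" by (simp add: divide_less_eq split: if_splits)
  \<comment> \<open>Since \<open>p\<close> determines \<open>p'\<close>, this constant depends only
    on d and p.\<close>
  define K where "K = (dirichlet_const p * dirichlet_const p') ^ d"
  have "K > 0" using assms p' by (auto simp: K_def dirichlet_const_def)
  have main: "\<exists>S f.
       S \<subseteq> ZN d N \<and>
       1 * real N powr \<alpha> \<le> real (card S) \<and> real (card S) \<le> 2 ^ d * real N powr \<alpha> \<and>
       supp d N f \<noteq> {} \<and>
       supp d N (fourier d N f) \<subseteq> S \<and>
       (1 / K) * (real N powr (- (real d / 2)) * lp_norm d N p f * lp_norm d N p' (fourier d N (indicator S)))
         \<le> linf_norm d N f \<and>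
       linf_norm d N f
         \<le> 1 * (real N powr (- (real d / 2)) * lp_norm d N p f * lp_norm d N p' (fourier d N (indicator S)))"
    if \<alpha>: "0 < \<alpha>" "\<alpha> < real d" and N: "N > 0" for \<alpha> N
  proof -
    obtain L where L: "0 < L" "L \<le> N"
      "real N powr \<alpha> \<le> real L ^ d" "real L ^ d \<le> 2 ^ d * real N powr \<alpha>"
      using side_length_exists[OF assms(1) \<alpha> N] .
    define g where "g = fourier d N (indicator (cube d L))"
    \<comment> \<open>Conjugation turns the transform into the inverse transform and keeps all
      moduli, hence all norms.\<close>
    define f where "f = (\<lambda>x. cnj (g x))"
    have norms: "lp_norm d N p f = lp_norm d N p g" "linf_norm d N f = linf_norm d N g"
      by (simp_all add: f_def lp_norm_def linf_norm_def)
    \<comment> \<open>At the origin \<open>f\<close> equals N^(-d/2) L^d, so it is not identically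
      zero.\<close>
    have "(\<lambda>j\<in>{..<d}. 0) \<in> supp d N f"
      using L N by (auto simp: supp_def ZN_eq_PiE f_def g_def fourier_indicator_cube)
    moreover have "supp d N (fourier d N f) \<subseteq> cube d L"
      unfolding f_def g_def using N L by (intro supp_fourier_cnj_fourier_indicator_cube) auto
    moreover note cube_estimates[of L N p p' d, folded g_def K_def]
    ultimately show ?thesis
      using L N assms p' \<open>K > 0\<close> cube_subset_ZN[of N L d]
      by (intro exI[of _ "cube d L"] exI[of _ f])
         (auto simp: card_cube norms divide_le_eq mult.commute simp flip: g_def)
  qed
  \<comment> \<open>The constants are fixed before \<open>\<alpha>\<close>: 1 and
    \<open>2 ^ d\<close> for the size of the set, \<open>1 / K\<close> and 1 for the norms. The
    bounds hold for every positive N.\<close>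
  show ?thesis
  proof (rule exI[of _ 1], intro conjI, simp, rule exI[of _ "2 ^ d"], intro conjI, simp,
      rule exI[of _ "1 / K"], intro conjI, simp add: \<open>K > 0\<close>, rule exI[of _ 1], intro conjI, simp,
      intro allI impI, elim conjE)
    fix \<alpha> :: real
    assume "0 < \<alpha>" "\<alpha> < real d"
    then show "\<forall>\<^sub>F N in sequentially. \<exists>S f.
       S \<subseteq> ZN d N \<and>
       1 * real N powr \<alpha> \<le> real (card S) \<and> real (card S) \<le> 2 ^ d * real N powr \<alpha> \<and>
       supp d N f \<noteq> {} \<and>
       supp d N (fourier d N f) \<subseteq> S \<and>
       (1 / K) * (real N powr (- (real d / 2)) * lp_norm d N p f * lp_norm d N p' (fourier d N (indicator S)))
         \<le> linf_norm d N f \<and>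
       linf_norm d N f
         \<le> 1 * (real N powr (- (real d / 2)) * lp_norm d N p f * lp_norm d N p' (fourier d N (indicator S)))"
      by (intro eventually_mono[OF eventually_gt_at_top[of 0]] main)
  qed
qed

end
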